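(* Let $\mathbb{X}$, $\mathbb{Y}$ and $\mathbb{W}$ be quasi-Banach spaces whose quasi-norms have constants $C_{\mathbb{X}}$, $C_{\mathbb{Y}}$ and $C_{\mathbb{W}}$, and let $T\in\mathcal{L}(\mathbb{X},\mathbb{Y})$. Then the approximation numbers $a_n$ have the following properties. (M$_a$) $\Vert T\Vert=a_{1}(T)\geq a_{2}(T)\geq\ldots\geq0$. (A$_a$) If $S\in\mathcal{L}(\mathbb{X},\mathbb{Y})$ and $n,m\in\mathbb{N}$, then $$a_{m+n-1}(S+T)\leq C_{\mathbb{Y}}\left(a_{m}(S)+a_{n}(T)\right);$$ correspondingly, when the quasi-norm of $\mathbb{Y}$ is replaced by an equivalent $\varrho$-norm with $\varrho\in(0,1]$ (and the approximation numbers are taken with respect to it), $a_{m+n-1}(S+T)^{\varrho}\leq a_{m}(S)^{\varrho}+a_{n}(T)^{\varrho}$. (P$_a$) If $S\in\mathcal{L}(\mathbb{Y},\mathbb{W})$ and $n,m\in\mathbb{N}$, then $a_{m+n-1}(ST)\leq a_{m}(S)\,a_{n}(T)$. (R$_a$) If $n\in\mathbb{N}$ and $\operatorname{rank}T<n$, then $a_{n}(T)=0$. (N$_a$) If $n\in\mathbb{N}$ and $\dim\mathbb{X}\geq n$, then $a_{n}(\mathrm{id}_{\mathbb{X}})=1$, where $\mathrm{id}_{\mathbb{X}}:\mathbb{X}\to\mathbb{X}$ is the identity. (C$_a$) If $\lim_{n\rightarrow\infty}a_{n}(T)=0$, then $T$ is compact.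
   Context: Vector spaces are over $\mathbb{K}=\mathbb{R}$ or $\mathbb{C}$. A quasi-norm with constant $C\geq1$ on a vector space $\mathbb{X}$ is a map $\Vert\cdot\Vert:\mathbb{X}\to[0,\infty)$ with $\Vert x\Vert=0\iff x=0$, $\Vert\lambda x\Vert=|\lambda|\Vert x\Vert$, and $\Vert x+y\Vert\leq C(\Vert x\Vert+\Vert y\Vert)$. For $\varrho\in(0,1]$, a $\varrho$-norm satisfies instead of the last condition $\Vert x+y\Vert^{\varrho}\leq\Vert x\Vert^{\varrho}+\Vert y\Vert^{\varrho}$. Two such functionals are equivalent if each is bounded by a constant multiple of the other; every quasi-norm has an equivalent $\varrho$-norm for some $\varrho\in(0,1]$. A quasi-Banach space is a complete quasi-normed space. $\mathcal{L}(\mathbb{X},\mathbb{Y})$ is the space of bounded linear operators, with $\Vert T\Vert=\sup_{\Vert x\Vert_{\mathbb{X}}\leq1}\Vert Tx\Vert_{\mathbb{Y}}$; $\operatorname{rank}T$ is the dimension of the range of $T$. An operator is compact if it maps bounded sets to relatively compact sets. For $n\in\mathbb{N}=\{1,2,\ldots\}$ and $T\in\mathcal{L}(\mathbb{X},\mathbb{Y})$, the $n$-th approximation number is $$a_{n}(T):=\inf\{\Vert T-S\Vert:\ S\in\mathcal{L}(\mathbb{X},\mathbb{Y}),\ \operatorname{rank}S<n\}.$$ *)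

theory Defs
  imports "HOL-Analysis.Analysis" "HOL-Library.Extended_Nat"
begin

(* Scalars: a commutative normed division algebra over the reals is isometrically
   isomorphic to the reals or the complex numbers (Gelfand-Mazur/Ostrowski), so a type of sort
   {real_normed_field, heine_borel} ranges over exactly these two fields.  Local compactness
   of the scalars is included so that no appeal to that classification is needed. *)

locale quasi_normed_space = vector_space scale
  for scale :: "'k::{real_normed_field,heine_borel} \<Rightarrow> 'a::ab_group_add \<Rightarrow> 'a" +
  fixes qnorm :: "'a \<Rightarrow> real" and C :: real
  assumes const_ge_1: "C \<ge> 1"
    and qnorm_nonneg: "qnorm x \<ge> 0"
    and qnorm_eq_0_iff: "qnorm x = 0 \<longleftrightarrow> x = 0"
    and qnorm_scale: "qnorm (scale c x) = norm c * qnorm x"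
    and qnorm_triangle: "qnorm (x + y) \<le> C * (qnorm x + qnorm y)"

locale quasi_banach_space = quasi_normed_space scale qnorm C
  for scale :: "'k::{real_normed_field,heine_borel} \<Rightarrow> 'a::ab_group_add \<Rightarrow> 'a"
    and qnorm :: "'a \<Rightarrow> real" and C :: real +
  assumes qnorm_complete:
    "(\<forall>e>0. \<exists>N. \<forall>m\<ge>N. \<forall>n\<ge>N. qnorm (f m - f n) < e) \<Longrightarrow>
       \<exists>l. (\<lambda>n. qnorm (f n - l)) \<longlonglongrightarrow> 0"

locale rho_normed_space = vector_space scale
  for scale :: "'k::{real_normed_field,heine_borel} \<Rightarrow> 'a::ab_group_add \<Rightarrow> 'a" +
  fixes rnorm :: "'a \<Rightarrow> real" and \<rho> :: real
  assumes rho_range: "0 < \<rho>" "\<rho> \<le> 1"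
    and rnorm_nonneg: "rnorm x \<ge> 0"
    and rnorm_eq_0_iff: "rnorm x = 0 \<longleftrightarrow> x = 0"
    and rnorm_scale: "rnorm (scale c x) = norm c * rnorm x"
    and rnorm_triangle: "rnorm (x + y) powr \<rho> \<le> rnorm x powr \<rho> + rnorm y powr \<rho>"

definition equivalent_qnorms :: "('a \<Rightarrow> real) \<Rightarrow> ('a \<Rightarrow> real) \<Rightarrow> bool" where
  "equivalent_qnorms q1 q2 \<longleftrightarrow>
     (\<exists>c. \<forall>x. q1 x \<le> c * q2 x) \<and> (\<exists>c. \<forall>x. q2 x \<le> c * q1 x)"

definition bounded_operator ::
    "('k::field \<Rightarrow> 'a::ab_group_add \<Rightarrow> 'a) \<Rightarrow> ('a \<Rightarrow> real) \<Rightarrow>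
     ('k \<Rightarrow> 'b::ab_group_add \<Rightarrow> 'b) \<Rightarrow> ('b \<Rightarrow> real) \<Rightarrow> ('a \<Rightarrow> 'b) \<Rightarrow> bool" where
  "bounded_operator sX qX sY qY T \<longleftrightarrow>
     Vector_Spaces.linear sX sY T \<and> (\<exists>M. \<forall>x. qY (T x) \<le> M * qX x)"

definition op_qnorm :: "('a \<Rightarrow> real) \<Rightarrow> ('b \<Rightarrow> real) \<Rightarrow> ('a \<Rightarrow> 'b) \<Rightarrow> real" where
  "op_qnorm qX qY T = (SUP x\<in>{x. qX x \<le> 1}. qY (T x))"

(* The library's dim is 0 on infinite-dimensional spaces, hence the explicit case distinction. *)
definition edim :: "('k::field \<Rightarrow> 'a::ab_group_add \<Rightarrow> 'a) \<Rightarrow> 'a set \<Rightarrow> enat" where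
  "edim s V =
     (if \<exists>B. finite B \<and> V \<subseteq> module.span s B then enat (vector_space.dim s V) else \<infinity>)"

definition op_rank :: "('k::field \<Rightarrow> 'b::ab_group_add \<Rightarrow> 'b) \<Rightarrow> ('a \<Rightarrow> 'b) \<Rightarrow> enat" where
  "op_rank sY T = edim sY (range T)"

(* Meaningful for n \<ge> 1 only: for n = 0 the infimum is over the empty set. *)
definition approx_number ::
    "('k::field \<Rightarrow> 'a::ab_group_add \<Rightarrow> 'a) \<Rightarrow> ('a \<Rightarrow> real) \<Rightarrow>
     ('k \<Rightarrow> 'b::ab_group_add \<Rightarrow> 'b) \<Rightarrow> ('b \<Rightarrow> real) \<Rightarrow> nat \<Rightarrow> ('a \<Rightarrow> 'b) \<Rightarrow> real" where
  "approx_number sX qX sY qY n T =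
     Inf {op_qnorm qX qY (\<lambda>x. T x - S x) |S.
            bounded_operator sX qX sY qY S \<and> op_rank sY S < enat n}"

(* Quasi-norm balls need not be open; a set is open iff it contains a ball around each of
   its points. *)
definition qnorm_topology :: "('a::ab_group_add \<Rightarrow> real) \<Rightarrow> 'a topology" where
  "qnorm_topology q =
     topology (\<lambda>U. \<forall>x\<in>U. \<exists>e>0. \<forall>y. q (y - x) < e \<longrightarrow> y \<in> U)"

lemma openin_qnorm_topology:
  "openin (qnorm_topology q) U \<longleftrightarrow> (\<forall>x\<in>U. \<exists>e>0. \<forall>y. q (y - x) < e \<longrightarrow> y \<in> U)"
proof -
  have "istopology (\<lambda>U. \<forall>x\<in>U. \<exists>e>0. \<forall>y. q (y - x) < e \<longrightarrow> y \<in> U)"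
    unfolding istopology_def
  proof (intro conjI allI impI ballI)
    fix S T x
    assume S: "\<forall>x\<in>S. \<exists>e>0. \<forall>y. q (y - x) < e \<longrightarrow> y \<in> S"
      and T: "\<forall>x\<in>T. \<exists>e>0. \<forall>y. q (y - x) < e \<longrightarrow> y \<in> T" and x: "x \<in> S \<inter> T"
    from S x obtain d where d: "d > 0" "\<forall>y. q (y - x) < d \<longrightarrow> y \<in> S" by blast
    from T x obtain e where e: "e > 0" "\<forall>y. q (y - x) < e \<longrightarrow> y \<in> T" by blast
    show "\<exists>e>0. \<forall>y. q (y - x) < e \<longrightarrow> y \<in> S \<inter> T"
      using d e by (intro exI[of _ "min d e"]) auto
  next
    fix K x
    assume "\<forall>S\<in>K. \<forall>x\<in>S. \<exists>e>0. \<forall>y. q (y - x) < e \<longrightarrow> y \<in> S" and "x \<in> \<Union>K"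
    then show "\<exists>e>0. \<forall>y. q (y - x) < e \<longrightarrow> y \<in> \<Union>K" by (meson UnionE UnionI)
  qed
  then show ?thesis
    unfolding qnorm_topology_def by (simp add: topology_inverse')
qed

definition relatively_compact :: "('a::ab_group_add \<Rightarrow> real) \<Rightarrow> 'a set \<Rightarrow> bool" where
  "relatively_compact q A \<longleftrightarrow> compactin (qnorm_topology q) (qnorm_topology q closure_of A)"

definition compact_operator ::
    "('a \<Rightarrow> real) \<Rightarrow> ('b::ab_group_add \<Rightarrow> real) \<Rightarrow> ('a \<Rightarrow> 'b) \<Rightarrow> bool" where
  "compact_operator qX qY T \<longleftrightarrow>
     (\<forall>B. (\<exists>M. \<forall>x\<in>B. qX x \<le> M) \<longrightarrow> relatively_compact qY (T ` B))"

end

theory Submission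
  imports Defs
begin

text \<open>The inequalities for approximation numbers all have the same origin. An operator has rank
  less than \<open>n\<close> iff fewer than \<open>n\<close> vectors span its range (\<open>edim_less_enat_iff\<close>), so ranks are
  subadditive, and \<open>(m - 1) + (n - 1) < m + n - 1\<close> accounts for the index. Given finite-rank
  approximants \<open>S\<^sub>0\<close> of \<open>S\<close> and \<open>T\<^sub>0\<close> of \<open>T\<close>, the operator \<open>S\<^sub>0 + T\<^sub>0\<close> approximates \<open>S + T\<close> with
  error \<open>(S - S\<^sub>0) + (T - T\<^sub>0)\<close>, and \<open>S\<^sub>0 (T - T\<^sub>0) + S T\<^sub>0\<close> approximates \<open>S T\<close> with error
  \<open>(S - S\<^sub>0) (T - T\<^sub>0)\<close>. Letting the approximants run through sequences that realise the infima
  (\<open>approximating_sequence\<close>) turns the bounds for the errors into bounds for the approximation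
  numbers, by continuity of the right-hand side.

  For the identity of a space of dimension at least \<open>n\<close>, an operator \<open>S\<close> of rank less than \<open>n\<close>
  kills some \<open>x \<noteq> 0\<close>, and \<open>id - S\<close> fixes this \<open>x\<close>, so that \<open>id - S\<close> has norm at least one.

  For compactness, a bounded set has a totally bounded image under an operator that is a limit of
  finite-rank operators, because bounded sets in finite-dimensional subspaces are totally bounded
  (\<open>totally_bounded_set_if_bounded_in_span\<close>). In a complete space, totally bounded
  sets are relatively compact (\<open>relatively_compact_if_totally_bounded\<close>). A quasi-norm need not be
  continuous for its own topology, so the arguments compare points only by the quasi-triangle
  inequality, without the metric of an equivalent \<open>\<rho>\<close>-norm, and treat finite-dimensional
  subspaces by adding one spanning vector at a time.\<close>

section \<open>Rank\<close>

text \<open>Turns every estimate of a rank into the construction of a small spanning set, which may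
  be dependent and need not lie in \<open>V\<close>.\<close>

lemma (in vector_space) edim_less_enat_iff:
  "edim scale V < enat n \<longleftrightarrow> (\<exists>B. finite B \<and> card B < n \<and> V \<subseteq> span B)"
proof
  assume less: "edim scale V < enat n"
  then obtain B0 where B0: "finite B0" "V \<subseteq> span B0"
    by (auto simp: edim_def split: if_splits)
  with less have dim: "dim V < n"
    by (auto simp: edim_def split: if_splits)
  obtain B where B: "B \<subseteq> V" "independent B" "V \<subseteq> span B" "card B = dim V"
    using basis_exists by blast
  have "finite B"
    using independent_span_bound[OF B0(1) B(2)] B(1) B0(2) by blast
  then show "\<exists>B. finite B \<and> card B < n \<and> V \<subseteq> span B"
    using B dim by auto
next
  assume "\<exists>B. finite B \<and> card B < n \<and> V \<subseteq> span B"
  then obtain B where "finite B" "card B < n" "V \<subseteq> span B" by blast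
  then show "edim scale V < enat n"
    using dim_le_card[of V B] by (auto simp: edim_def)
qed

section \<open>Quasi-normed spaces\<close>

context quasi_normed_space
begin

lemma const_pos: "C > 0"
  using const_ge_1 by linarith

lemma qnorm_zero [simp]: "qnorm 0 = 0"
  using qnorm_eq_0_iff by blast

lemma qnorm_minus [simp]: "qnorm (- x) = qnorm x"
  using qnorm_scale[of "-1" x] by simp

lemma qnorm_minus_commute: "qnorm (x - y) = qnorm (y - x)"
  using qnorm_minus[of "x - y"] by simp

text \<open>Plays the role of splitting \<open>\<epsilon>\<close> into two halves; the constant of the quasi-norm makes the
  share of each summand smaller.\<close>

lemma qnorm_add_less:
  assumes "qnorm x < e / (2 * C)" "qnorm y < e / (2 * C)"
  shows "qnorm (x + y) < e"
proof -
  have "qnorm (x + y) \<le> C * (qnorm x + qnorm y)"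
    by (rule qnorm_triangle)
  also have "\<dots> < C * (e / (2 * C) + e / (2 * C))"
    using assms const_pos by (intro mult_strict_left_mono) auto
  also have "\<dots> = e"
    using const_pos by (simp add: field_simps)
  finally show ?thesis .
qed

lemma qnorm_less_via:
  assumes "qnorm (x - y) < e / (2 * C)" "qnorm (y - z) < e / (2 * C)"
  shows "qnorm (x - z) < e"
  using qnorm_add_less[OF assms] by simp

subsection \<open>Total boundedness and relative compactness\<close>

definition totally_bounded_set :: "'a set \<Rightarrow> bool" where
  "totally_bounded_set A \<longleftrightarrow> (\<forall>e>0. \<exists>F. finite F \<and> (\<forall>a\<in>A. \<exists>f\<in>F. qnorm (a - f) < e))"

text \<open>Indexes the net condition by the arguments of \<open>g\<close>, the form in which it is used for
  images.\<close>

lemma totally_bounded_set_image_net: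
  assumes "totally_bounded_set (g ` A)" "e > 0"
  shows "\<exists>F. finite F \<and> (\<forall>a\<in>A. \<exists>f\<in>F. qnorm (g a - f) < e)"
  using assms by (simp add: totally_bounded_set_def)

lemma topspace_qnorm_topology [simp]: "topspace (qnorm_topology qnorm) = UNIV"
proof -
  have "openin (qnorm_topology qnorm) UNIV"
    unfolding openin_qnorm_topology by (auto intro: exI[of _ 1])
  then show ?thesis
    using openin_subset by blast
qed

text \<open>Although balls need not be open, they are neighbourhoods of their centre: the points
  around which some ball still fits into the given one form an open set, by the quasi-triangle
  inequality.\<close>

lemma in_closure_of_iff:
  "y \<in> qnorm_topology qnorm closure_of A \<longleftrightarrow> (\<forall>e>0. \<exists>a\<in>A. qnorm (a - y) < e)"
proof
  assume y: "y \<in> qnorm_topology qnorm closure_of A"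
  show "\<forall>e>0. \<exists>a\<in>A. qnorm (a - y) < e"
  proof (intro allI impI)
    fix e :: real assume e: "e > 0"
    define U where "U = {z. \<exists>d>0. \<forall>w. qnorm (w - z) < d \<longrightarrow> qnorm (w - y) < e}"
    have "openin (qnorm_topology qnorm) U"
      unfolding openin_qnorm_topology
    proof
      fix z assume "z \<in> U"
      then obtain d where d: "d > 0" "\<And>w. qnorm (w - z) < d \<Longrightarrow> qnorm (w - y) < e"
        by (auto simp: U_def)
      have d': "d / (2 * C) > 0"
        using d(1) const_pos by simp
      have "u \<in> U" if "qnorm (u - z) < d / (2 * C)" for u
        unfolding U_def using that d(2) qnorm_less_via d' by blast
      then show "\<exists>d>0. \<forall>u. qnorm (u - z) < d \<longrightarrow> u \<in> U"
        using d' by blast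
    qed
    moreover have "y \<in> U"
      using e by (auto simp: U_def)
    ultimately obtain a where "a \<in> A" "a \<in> U"
      using y unfolding in_closure_of by blast
    then obtain d where "d > 0" "\<forall>w. qnorm (w - a) < d \<longrightarrow> qnorm (w - y) < e"
      by (auto simp: U_def)
    then have "qnorm (a - y) < e" by simp
    with \<open>a \<in> A\<close> show "\<exists>a\<in>A. qnorm (a - y) < e" by blast
  qed
next
  assume close: "\<forall>e>0. \<exists>a\<in>A. qnorm (a - y) < e"
  show "y \<in> qnorm_topology qnorm closure_of A"
    unfolding in_closure_of
  proof (intro conjI allI impI)
    fix U assume "y \<in> U \<and> openin (qnorm_topology qnorm) U"
    then obtain e where "e > 0" "\<forall>z. qnorm (z - y) < e \<longrightarrow> z \<in> U"
      unfolding openin_qnorm_topology by blast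
    then show "\<exists>a. a \<in> A \<and> a \<in> U"
      using close by blast
  qed simp
qed

lemma totally_bounded_set_closure_of:
  assumes "totally_bounded_set A"
  shows "totally_bounded_set (qnorm_topology qnorm closure_of A)"
  unfolding totally_bounded_set_def
proof (intro allI impI)
  fix e :: real assume "e > 0"
  then have e': "e / (2 * C) > 0"
    using const_pos by simp
  then obtain F where F: "finite F" "\<forall>a\<in>A. \<exists>f\<in>F. qnorm (a - f) < e / (2 * C)"
    using assms unfolding totally_bounded_set_def by blast
  have "\<exists>f\<in>F. qnorm (y - f) < e" if y: "y \<in> qnorm_topology qnorm closure_of A" for y
  proof -
    obtain a where "a \<in> A" and a: "qnorm (a - y) < e / (2 * C)"
      using y e' unfolding in_closure_of_iff by blast
    with F(2) obtain f where "f \<in> F" "qnorm (a - f) < e / (2 * C)" by blast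
    then show ?thesis
      using a qnorm_less_via[of y a e f] by (auto simp: qnorm_minus_commute[of y a])
  qed
  then show "\<exists>F. finite F \<and> (\<forall>y\<in>qnorm_topology qnorm closure_of A. \<exists>f\<in>F. qnorm (y - f) < e)"
    using F(1) by blast
qed

lemma totally_bounded_set_finite_small_cover:
  assumes "totally_bounded_set K" "e > 0"
  obtains G where "finite G" "K = \<Union> G" "\<And>P u v. P \<in> G \<Longrightarrow> u \<in> P \<Longrightarrow> v \<in> P \<Longrightarrow> qnorm (u - v) < e"
proof -
  have "e / (2 * C) > 0"
    using assms(2) const_pos by simp
  then obtain F where F: "finite F" "\<forall>a\<in>K. \<exists>f\<in>F. qnorm (a - f) < e / (2 * C)"
    using assms(1) unfolding totally_bounded_set_def by blast
  let ?G = "(\<lambda>f. {a \<in> K. qnorm (a - f) < e / (2 * C)}) ` F"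
  show thesis
  proof (rule that[of ?G])
    fix P u v assume "P \<in> ?G" "u \<in> P" "v \<in> P"
    then obtain f where "qnorm (u - f) < e / (2 * C)" "qnorm (v - f) < e / (2 * C)"
      by auto
    then show "qnorm (u - v) < e"
      using qnorm_less_via[of u f e v] by (simp add: qnorm_minus_commute[of v f])
  qed (use F in auto)
qed

end

text \<open>The classical bisection proof of the Heine--Borel theorem: if some open cover
  of the closure had no finite subcover, there would be a decreasing sequence of pieces of
  diameters tending to zero without a finite subcover. They shrink to a point, and one member
  of the cover around this point already contains all late pieces.\<close>

lemma (in quasi_banach_space) relatively_compact_if_totally_bounded:
  assumes "totally_bounded_set A"
  shows "relatively_compact qnorm A"
  unfolding relatively_compact_def compactin_def
proof (intro conjI allI impI)
  define K where "K = qnorm_topology qnorm closure_of A"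
  fix \<U> assume cover: "(\<forall>U\<in>\<U>. openin (qnorm_topology qnorm) U)
      \<and> qnorm_topology qnorm closure_of A \<subseteq> \<Union> \<U>"
  define uncov where "uncov P \<longleftrightarrow> \<not> (\<exists>F. finite F \<and> F \<subseteq> \<U> \<and> P \<subseteq> \<Union> F)" for P
  have tb: "totally_bounded_set K"
    unfolding K_def by (rule totally_bounded_set_closure_of[OF assms])
  have split: "\<exists>Q\<subseteq>P. uncov Q \<and> (\<forall>u\<in>Q. \<forall>v\<in>Q. qnorm (u - v) < e)"
    if P: "uncov P" "P \<subseteq> K" and e: "e > 0" for P e
  proof (rule ccontr)
    assume none: "\<not> ?thesis"
    obtain G where G: "finite G" "K = \<Union> G"
      "\<And>Q u v. Q \<in> G \<Longrightarrow> u \<in> Q \<Longrightarrow> v \<in> Q \<Longrightarrow> qnorm (u - v) < e"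
      using totally_bounded_set_finite_small_cover[OF tb e] by blast
    have "\<forall>Q\<in>G. \<exists>F. finite F \<and> F \<subseteq> \<U> \<and> P \<inter> Q \<subseteq> \<Union> F"
    proof
      fix Q assume "Q \<in> G"
      then have "\<forall>u\<in>P \<inter> Q. \<forall>v\<in>P \<inter> Q. qnorm (u - v) < e"
        using G(3) by blast
      with none have "\<not> uncov (P \<inter> Q)"
        by (meson Int_lower1)
      then show "\<exists>F. finite F \<and> F \<subseteq> \<U> \<and> P \<inter> Q \<subseteq> \<Union> F"
        unfolding uncov_def by blast
    qed
    then obtain F where F: "\<forall>Q\<in>G. finite (F Q) \<and> F Q \<subseteq> \<U> \<and> P \<inter> Q \<subseteq> \<Union> (F Q)"
      by metis
    have "finite (\<Union> (F ` G)) \<and> \<Union> (F ` G) \<subseteq> \<U> \<and> P \<subseteq> \<Union> (\<Union> (F ` G))"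
    proof (intro conjI)
      show "P \<subseteq> \<Union> (\<Union> (F ` G))"
      proof
        fix x assume "x \<in> P"
        with P(2) G(2) obtain Q where Q: "Q \<in> G" "x \<in> Q" by blast
        with \<open>x \<in> P\<close> F have "x \<in> \<Union> (F Q)" by fast
        with Q(1) show "x \<in> \<Union> (\<Union> (F ` G))" by blast
      qed
    qed (use F G(1) in auto)
    then show False
      using P(1) unfolding uncov_def by blast
  qed
  show "\<exists>F. finite F \<and> F \<subseteq> \<U> \<and> qnorm_topology qnorm closure_of A \<subseteq> \<Union> F"
  proof (rule ccontr)
    assume "\<not> ?thesis"
    then have "uncov K"
      by (simp add: uncov_def K_def)
    \<comment> \<open>pieces without a finite subcover whose diameters tend to zero\<close>
    let ?small = "\<lambda>n P. uncov P \<and> P \<subseteq> K \<and> (\<forall>u\<in>P. \<forall>v\<in>P. qnorm (u - v) < inverse (real (Suc n)))"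
    have "\<exists>P. \<forall>n. ?small n (P n) \<and> P (Suc n) \<subseteq> P n"
    proof (rule dependent_nat_choice)
      show "\<exists>P. ?small 0 P"
        using split[OF \<open>uncov K\<close> subset_refl, of "inverse (real (Suc 0))"] by auto
      fix P n assume "?small n P"
      then show "\<exists>Q. ?small (Suc n) Q \<and> Q \<subseteq> P"
        using split[of P "inverse (real (Suc (Suc n)))"]
        by (metis inverse_positive_iff_positive of_nat_0_less_iff subset_trans zero_less_Suc)
    qed
    then obtain P where P: "\<And>n. uncov (P n)" "\<And>n. P n \<subseteq> K" "\<And>n. P (Suc n) \<subseteq> P n"
      and diam: "\<And>n u v. u \<in> P n \<Longrightarrow> v \<in> P n \<Longrightarrow> qnorm (u - v) < inverse (real (Suc n))"
      by metis
    have "P n \<noteq> {}" for n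
      using P(1)[of n] unfolding uncov_def by (metis empty_subsetI finite.emptyI)
    then obtain x where x: "\<And>n. x n \<in> P n"
      by (meson ex_in_conv)
    have anti: "P m \<subseteq> P n" if "n \<le> m" for m n
      using lift_Suc_antimono_le[of P] P(3) that by blast
    have "\<forall>e>0. \<exists>N. \<forall>m\<ge>N. \<forall>n\<ge>N. qnorm (x m - x n) < e"
    proof (intro allI impI)
      fix e :: real assume "e > 0"
      then obtain N where N: "inverse (real (Suc N)) < e"
        using reals_Archimedean by blast
      have "qnorm (x m - x n) < e" if "m \<ge> N" "n \<ge> N" for m n
        using diam[of "x m" N "x n"] x anti[OF that(1)] anti[OF that(2)] N
        by (meson less_trans subsetD)
      then show "\<exists>N. \<forall>m\<ge>N. \<forall>n\<ge>N. qnorm (x m - x n) < e" by blast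
    qed
    then obtain l where l: "(\<lambda>n. qnorm (x n - l)) \<longlonglongrightarrow> 0"
      using qnorm_complete by blast
    have "l \<in> K"
      unfolding K_def in_closure_of_iff
    proof (intro allI impI)
      fix e :: real assume "e > 0"
      then have e': "e / (2 * C) > 0"
        using const_pos by simp
      from order_tendstoD(2)[OF l e'] obtain n where n: "qnorm (x n - l) < e / (2 * C)"
        by (auto simp: eventually_sequentially)
      have "x n \<in> K"
        using x P(2) by blast
      then obtain a where "a \<in> A" "qnorm (a - x n) < e / (2 * C)"
        using e' unfolding K_def in_closure_of_iff by blast
      then show "\<exists>a\<in>A. qnorm (a - l) < e"
        using n qnorm_less_via by blast
    qed
    then obtain U where U: "U \<in> \<U>" "l \<in> U" "openin (qnorm_topology qnorm) U"
      using cover unfolding K_def by blast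
    then obtain e where e: "e > 0" "\<And>y. qnorm (y - l) < e \<Longrightarrow> y \<in> U"
      unfolding openin_qnorm_topology by blast
    then have e': "e / (2 * C) > 0"
      using const_pos by simp
    then obtain N where N: "inverse (real (Suc N)) < e / (2 * C)"
      using reals_Archimedean by blast
    from order_tendstoD(2)[OF l e'] obtain N' where
      N': "\<And>n. n \<ge> N' \<Longrightarrow> qnorm (x n - l) < e / (2 * C)"
      by (auto simp: eventually_sequentially)
    define n where "n = max N N'"
    have "P n \<subseteq> U"
    proof
      fix y assume y: "y \<in> P n"
      have "qnorm (y - x n) < e / (2 * C)"
        using diam[of y N "x n"] anti[of N n] x[of n] y N by (force simp: n_def)
      moreover have "qnorm (x n - l) < e / (2 * C)"
        by (rule N') (simp add: n_def)
      ultimately show "y \<in> U"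
        using e(2) qnorm_less_via by blast
    qed
    then show False
      using P(1)[of n] U(1) unfolding uncov_def
      by (metis cSup_singleton empty_subsetI finite.emptyI finite_insert insert_subset)
  qed
qed simp

subsection \<open>Finite-dimensional subspaces\<close>

context quasi_normed_space
begin

text \<open>Dividing \<open>a\<close> by \<open>k\<close> gives a vector of the form \<open>b - v\<close> with \<open>v\<close> in the span of \<open>B\<close>. A positive
  distance of \<open>b\<close> from this span therefore makes the coefficient of \<open>b\<close> a bounded functional.\<close>

lemma coefficient_bound:
  assumes a: "a - scale k b \<in> span B" and dist: "\<And>v. v \<in> span B \<Longrightarrow> \<delta> \<le> qnorm (b - v)"
  shows "norm k * \<delta> \<le> qnorm a"
proof (cases "k = 0")
  case True
  then show ?thesis using qnorm_nonneg by simp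
next
  case False
  let ?v = "- scale (inverse k) (a - scale k b)"
  have "?v \<in> span B"
    using a by (intro span_neg span_scale)
  then have "\<delta> \<le> qnorm (b - ?v)"
    by (rule dist)
  also have "b - ?v = scale (inverse k) a"
    using False by (simp add: scale_right_diff_distrib)
  finally have "\<delta> \<le> inverse (norm k) * qnorm a"
    by (simp add: qnorm_scale norm_inverse)
  then show ?thesis
    using False by (simp add: field_simps)
qed

text \<open>When \<open>b\<close> is added to \<open>B\<close>, the induction hypothesis gives \<open>b\<close> a positive distance from the
  span of \<open>B\<close>. If vectors \<open>w n\<close> of the larger span tend to \<open>y\<close>, then their coefficients
  of \<open>b\<close> form a Cauchy sequence of scalars; with its limit \<open>c\<close>, the vector \<open>y - c b\<close> is a limit of
  elements of the span of \<open>B\<close>, to which the induction hypothesis applies again.\<close>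

lemma span_finite_closed:
  assumes "finite B" "\<And>e. e > 0 \<Longrightarrow> \<exists>v\<in>span B. qnorm (y - v) < e"
  shows "y \<in> span B"
  using assms
proof (induction B arbitrary: y rule: finite_induct)
  case empty
  have "qnorm y < e" if "e > 0" for e
    using empty[OF that] by simp
  then have "qnorm y \<le> 0"
    by (meson less_irrefl not_le)
  then have "y = 0"
    using qnorm_nonneg[of y] qnorm_eq_0_iff by (metis order_antisym)
  then show ?case by simp
next
  case (insert b B)
  show ?case
  proof (cases "b \<in> span B")
    case True
    with insert show ?thesis by (metis span_redundant)
  next
    case False
    then obtain \<delta> where \<delta>: "\<delta> > 0" "\<And>v. v \<in> span B \<Longrightarrow> \<delta> \<le> qnorm (b - v)"
      using insert.IH[of b] by (meson not_less)
    have "\<exists>w\<in>span (insert b B). qnorm (y - w) < inverse (real (Suc n))" for n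
      by (rule insert.prems) simp
    then obtain w where w: "\<And>n. w n \<in> span (insert b B)"
      and yw: "\<And>n. qnorm (y - w n) < inverse (real (Suc n))"
      by metis
    from w obtain k where k: "\<And>n. w n - scale (k n) b \<in> span B"
      unfolding span_breakdown_eq by metis
    have lim: "(\<lambda>n. qnorm (y - w n)) \<longlonglongrightarrow> 0"
      by (rule tendsto_sandwich[OF _ _ tendsto_const LIMSEQ_inverse_real_of_nat])
        (use yw in \<open>auto simp: qnorm_nonneg intro!: always_eventually less_imp_le\<close>)
    have "Cauchy k"
      unfolding Cauchy_def
    proof (intro allI impI)
      fix e :: real assume "e > 0"
      then have "e * \<delta> / (2 * C) > 0"
        using \<delta>(1) const_pos by simp
      from order_tendstoD(2)[OF lim this] obtain N
        where N: "\<And>n. n \<ge> N \<Longrightarrow> qnorm (y - w n) < e * \<delta> / (2 * C)"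
        by (auto simp: eventually_sequentially)
      have "dist (k m) (k n) < e" if "m \<ge> N" "n \<ge> N" for m n
      proof -
        have "(w m - scale (k m) b) - (w n - scale (k n) b) \<in> span B"
          by (intro span_diff k)
        then have "(w m - w n) - scale (k m - k n) b \<in> span B"
          by (simp add: scale_left_diff_distrib algebra_simps)
        then have "norm (k m - k n) * \<delta> \<le> qnorm (w m - w n)"
          by (rule coefficient_bound) (rule \<delta>(2))
        also have "\<dots> < e * \<delta>"
          using qnorm_less_via[of "w m" y "e * \<delta>" "w n"] N[OF that(1)] N[OF that(2)]
          by (simp add: qnorm_minus_commute[of "w m" y])
        finally show ?thesis
          using \<delta>(1) by (simp add: dist_norm)
      qed
      then show "\<exists>N. \<forall>m\<ge>N. \<forall>n\<ge>N. dist (k m) (k n) < e" by blast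
    qed
    then obtain c where c: "k \<longlonglongrightarrow> c"
      using Cauchy_convergent convergent_def by blast
    have "(\<lambda>n. C * (qnorm (y - w n) + norm (k n - c) * qnorm b)) \<longlonglongrightarrow> C * (0 + norm (c - c) * qnorm b)"
      by (intro tendsto_intros lim c)
    then have lim': "(\<lambda>n. C * (qnorm (y - w n) + norm (k n - c) * qnorm b)) \<longlonglongrightarrow> 0"
      by simp
    have "y - scale c b \<in> span B"
    proof (rule insert.IH)
      fix e :: real assume "e > 0"
      from order_tendstoD(2)[OF lim' this] obtain n
        where n: "C * (qnorm (y - w n) + norm (k n - c) * qnorm b) < e"
        by (auto simp: eventually_sequentially)
      have "(y - scale c b) - (w n - scale (k n) b) = (y - w n) + scale (k n - c) b"
        by (simp add: scale_left_diff_distrib algebra_simps)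
      then have "qnorm ((y - scale c b) - (w n - scale (k n) b))
          \<le> C * (qnorm (y - w n) + norm (k n - c) * qnorm b)"
        using qnorm_triangle[of "y - w n" "scale (k n - c) b"] by (simp only: qnorm_scale)
      with n k[of n] show "\<exists>v\<in>span B. qnorm (y - scale c b - v) < e"
        by force
    qed
    then show ?thesis
      unfolding span_breakdown_eq by blast
  qed
qed

text \<open>When \<open>b\<close> is added to \<open>B\<close>, the coefficients of \<open>b\<close> stay in a disc, which is compact, and the
  remainders stay in a bounded subset of the span of \<open>B\<close>. Sums of elements of a net
  for each part form a net of the whole set.\<close>

lemma totally_bounded_set_if_bounded_in_span:
  assumes "finite B" "A \<subseteq> span B" "\<And>a. a \<in> A \<Longrightarrow> qnorm a \<le> M"
  shows "totally_bounded_set A"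
  using assms
proof (induction B arbitrary: A M rule: finite_induct)
  case empty
  then have "\<forall>a\<in>A. \<exists>f\<in>{0}. qnorm (a - f) < e" if "e > 0" for e
    using that by auto
  then show ?case
    unfolding totally_bounded_set_def by (meson finite.emptyI finite_insert)
next
  case (insert b B)
  show ?case
  proof (cases "b \<in> span B")
    case True
    with insert show ?thesis by (metis span_redundant)
  next
    case False
    then obtain \<delta> where \<delta>: "\<delta> > 0" "\<And>v. v \<in> span B \<Longrightarrow> \<delta> \<le> qnorm (b - v)"
      using span_finite_closed[OF insert.hyps(1), of b] by (meson not_less)
    have "\<forall>a\<in>A. \<exists>k. a - scale k b \<in> span B"
      using insert.prems(1) span_breakdown_eq by blast
    then obtain k where k: "\<And>a. a \<in> A \<Longrightarrow> a - scale (k a) b \<in> span B"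
      by metis
    have k_bound: "norm (k a) \<le> M / \<delta>" if "a \<in> A" for a
    proof -
      have "norm (k a) * \<delta> \<le> qnorm a"
        using coefficient_bound[OF k[OF that]] \<delta>(2) by blast
      also have "\<dots> \<le> M"
        by (rule insert.prems(2)[OF that])
      finally show ?thesis
        using \<delta>(1) by (simp add: field_simps)
    qed
    have tb: "totally_bounded_set ((\<lambda>a. a - scale (k a) b) ` A)"
    proof (rule insert.IH)
      fix v assume "v \<in> (\<lambda>a. a - scale (k a) b) ` A"
      then obtain a where a: "a \<in> A" "v = a - scale (k a) b" by blast
      have "qnorm v \<le> C * (qnorm a + norm (k a) * qnorm b)"
        using qnorm_triangle[of a "- scale (k a) b"] a(2) by (simp add: qnorm_scale)
      also have "\<dots> \<le> C * (M + M / \<delta> * qnorm b)"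
        using const_pos insert.prems(2)[OF a(1)] k_bound[OF a(1)] qnorm_nonneg
        by (intro mult_left_mono add_mono mult_right_mono) auto
      finally show "qnorm v \<le> C * (M + M / \<delta> * qnorm b)" .
    qed (use k in blast)
    show ?thesis
      unfolding totally_bounded_set_def
    proof (intro allI impI)
      fix e :: real assume e: "e > 0"
      then have e': "e / (2 * C) > 0"
        using const_pos by simp
      then obtain F where F: "finite F" "\<And>a. a \<in> A \<Longrightarrow> \<exists>f\<in>F. qnorm (a - scale (k a) b - f) < e / (2 * C)"
        using totally_bounded_set_image_net[OF tb] by meson
      \<comment> \<open>an error below \<open>r\<close> in the coefficient moves the vector by less than \<open>e / (2 * C)\<close>;
        adding one keeps the divisor positive\<close>
      define r where "r = e / (2 * C) / (qnorm b + 1)"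
      have qb: "qnorm b + 1 > 0"
        using qnorm_nonneg[of b] by linarith
      have r: "r > 0"
        unfolding r_def using e' qb by (rule divide_pos_pos)
      then obtain S where S: "finite S" "cball 0 (M / \<delta>) \<subseteq> (\<Union>c\<in>S. ball (c::'k) r)"
        using compact_cball[of "0::'k"] unfolding compact_eq_totally_bounded by meson
      let ?N = "(\<lambda>(f, c). f + scale c b) ` (F \<times> S)"
      have "\<exists>g\<in>?N. qnorm (a - g) < e" if a: "a \<in> A" for a
      proof -
        obtain f where f: "f \<in> F" "qnorm (a - scale (k a) b - f) < e / (2 * C)"
          using F(2)[OF a] by blast
        have "k a \<in> cball 0 (M / \<delta>)"
          using k_bound[OF a] by simp
        then obtain c where c: "c \<in> S" "norm (k a - c) < r"
          using S(2) by (auto simp: dist_norm norm_minus_commute)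
        have "norm (k a - c) * qnorm b \<le> norm (k a - c) * (qnorm b + 1)"
          by (intro mult_left_mono) auto
        also have "\<dots> < r * (qnorm b + 1)"
          using c(2) qb by (rule mult_strict_right_mono)
        also have "\<dots> = e / (2 * C)"
          using qb by (simp add: r_def)
        finally have "qnorm (scale (k a - c) b) < e / (2 * C)"
          by (simp add: qnorm_scale)
        from qnorm_add_less[OF f(2) this]
        have "qnorm (a - (f + scale c b)) < e"
          by (simp add: scale_left_diff_distrib algebra_simps)
        moreover have "f + scale c b \<in> ?N"
          using f(1) c(1) by auto
        ultimately show ?thesis by blast
      qed
      moreover have "finite ?N"
        using F(1) S(1) by blast
      ultimately show "\<exists>F. finite F \<and> (\<forall>a\<in>A. \<exists>f\<in>F. qnorm (a - f) < e)"
        by blast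
    qed
  qed
qed

end

section \<open>Operators between quasi-normed spaces\<close>

locale quasi_normed_space_pair =
  X: quasi_normed_space sX qX CX + Y: quasi_normed_space sY qY CY
  for sX :: "'k::{real_normed_field,heine_borel} \<Rightarrow> 'x::ab_group_add \<Rightarrow> 'x"
    and qX :: "'x \<Rightarrow> real" and CX :: real
    and sY :: "'k \<Rightarrow> 'y::ab_group_add \<Rightarrow> 'y"
    and qY :: "'y \<Rightarrow> real" and CY :: real
begin

sublocale vector_space_pair sX sY
  by unfold_locales

abbreviation "bounded_op \<equiv> bounded_operator sX qX sY qY"
abbreviation "op_norm \<equiv> op_qnorm qX qY"
abbreviation "rk \<equiv> op_rank sY"
abbreviation "a_num \<equiv> approx_number sX qX sY qY"

lemma bounded_op_bound:
  assumes "bounded_op T"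
  obtains M where "M \<ge> 0" "\<And>x. qY (T x) \<le> M * qX x"
proof -
  obtain M where M: "\<And>x. qY (T x) \<le> M * qX x"
    using assms by (auto simp: bounded_operator_def)
  have "qY (T x) \<le> max M 0 * qX x" for x
    by (rule order_trans[OF M mult_right_mono]) (auto simp: X.qnorm_nonneg)
  then show thesis
    by (intro that[of "max M 0"]) auto
qed

lemma bounded_op_zero: "bounded_op (\<lambda>x. 0)"
  unfolding bounded_operator_def using linear_zero
  by (auto intro: exI[of _ 0])

lemma bounded_op_add:
  assumes "bounded_op S" "bounded_op T"
  shows "bounded_op (\<lambda>x. S x + T x)"
proof -
  obtain M where M: "\<And>x. qY (S x) \<le> M * qX x"
    using bounded_op_bound[OF assms(1)] by blast
  obtain N where N: "\<And>x. qY (T x) \<le> N * qX x"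
    using bounded_op_bound[OF assms(2)] by blast
  have "qY (S x + T x) \<le> CY * (M + N) * qX x" for x
  proof -
    have "qY (S x + T x) \<le> CY * (qY (S x) + qY (T x))"
      by (rule Y.qnorm_triangle)
    also have "\<dots> \<le> CY * (M * qX x + N * qX x)"
      using M N Y.const_pos by (intro mult_left_mono add_mono) auto
    finally show ?thesis
      by (simp add: algebra_simps)
  qed
  then show ?thesis
    using assms linear_compose_add unfolding bounded_operator_def by blast
qed

lemma bounded_op_diff:
  assumes "bounded_op S" "bounded_op T"
  shows "bounded_op (\<lambda>x. S x - T x)"
proof -
  have "bounded_op (\<lambda>x. - T x)"
    using assms(2) linear_compose_neg unfolding bounded_operator_def by simp
  from bounded_op_add[OF assms(1) this] show ?thesis by simp
qed

lemma bounded_op_linear: "bounded_op T \<Longrightarrow> Vector_Spaces.linear sX sY T"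
  by (simp add: bounded_operator_def)

lemma op_norm_leI:
  assumes "\<And>x. qX x \<le> 1 \<Longrightarrow> qY (T x) \<le> M"
  shows "op_norm T \<le> M"
proof -
  have "(0::'x) \<in> {x. qX x \<le> 1}" by simp
  then show ?thesis
    unfolding op_qnorm_def using assms by (intro cSUP_least) blast+
qed

lemma op_norm_upper:
  assumes "bounded_op T" "qX x \<le> 1"
  shows "qY (T x) \<le> op_norm T"
proof -
  obtain M where M: "M \<ge> 0" "\<And>x. qY (T x) \<le> M * qX x"
    using bounded_op_bound[OF assms(1)] by blast
  have "qY (T x) \<le> M" if "qX x \<le> 1" for x
    using M(2)[of x] mult_left_mono[OF that M(1)] by simp
  then have "bdd_above ((\<lambda>x. qY (T x)) ` {x. qX x \<le> 1})"
    by (intro bdd_aboveI2) auto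
  then show ?thesis
    unfolding op_qnorm_def using assms(2) by (intro cSUP_upper) auto
qed

lemma op_norm_nonneg: "bounded_op T \<Longrightarrow> 0 \<le> op_norm T"
  using op_norm_upper[of T 0] Y.qnorm_nonneg[of "T 0"] by simp

text \<open>Homogeneity: divide \<open>x\<close> by its quasi-norm, a real number and hence a scalar.\<close>

lemma op_norm_bound:
  assumes T: "bounded_op T"
  shows "qY (T x) \<le> op_norm T * qX x"
proof (cases "x = 0")
  case True
  then show ?thesis
    using linear_0[OF bounded_op_linear[OF T]] by simp
next
  case False
  then have pos: "qX x > 0"
    using X.qnorm_nonneg[of x] X.qnorm_eq_0_iff[of x] by linarith
  let ?c = "of_real (inverse (qX x)) :: 'k"
  have c: "norm ?c = inverse (qX x)"
    using pos by (simp del: of_real_inverse)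
  have "qX (sX ?c x) \<le> 1"
    unfolding X.qnorm_scale c using pos by simp
  then have "qY (T (sX ?c x)) \<le> op_norm T"
    by (rule op_norm_upper[OF T])
  then have "inverse (qX x) * qY (T x) \<le> op_norm T"
    unfolding linear_scale[OF bounded_op_linear[OF T]] Y.qnorm_scale c .
  then show ?thesis
    using pos by (simp add: field_simps)
qed

lemma op_rank_less_iff:
  "rk T < enat n \<longleftrightarrow> (\<exists>B. finite B \<and> card B < n \<and> range T \<subseteq> Y.span B)"
  unfolding op_rank_def by (rule Y.edim_less_enat_iff)

text \<open>The union of the two spanning sets has at most \<open>(m - 1) + (n - 1)\<close> elements.\<close>

lemma op_rank_add_less:
  assumes "rk S < enat m" "rk T < enat n"
  shows "rk (\<lambda>x. S x + T x) < enat (m + n - 1)"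
proof -
  obtain A B where A: "finite A" "card A < m" "range S \<subseteq> Y.span A"
    and B: "finite B" "card B < n" "range T \<subseteq> Y.span B"
    using assms unfolding op_rank_less_iff by blast
  have "card (A \<union> B) < m + n - 1"
    using card_Un_le[of A B] A(2) B(2) by linarith
  moreover have "S x + T x \<in> Y.span (A \<union> B)" for x
    using A(3) B(3) Y.span_mono[of A "A \<union> B"] Y.span_mono[of B "A \<union> B"]
    by (intro Y.span_add) auto
  ultimately show ?thesis
    unfolding op_rank_less_iff using A(1) B(1) by (intro exI[of _ "A \<union> B"]) auto
qed

lemma op_rank_less_1_iff: "rk T < enat 1 \<longleftrightarrow> (\<forall>x. T x = 0)"
proof -
  have "rk T < enat 1 \<longleftrightarrow> range T \<subseteq> Y.span {}"
    unfolding op_rank_less_iff by (auto intro!: exI[of _ "{}"])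
  then show ?thesis by auto
qed

section \<open>Approximation numbers\<close>

lemma approx_number_bdd_below:
  assumes "bounded_op T"
  shows "bdd_below {op_norm (\<lambda>x. T x - S x) |S. bounded_op S \<and> rk S < enat n}"
  using assms by (intro bdd_belowI[of _ 0]) (auto intro!: op_norm_nonneg bounded_op_diff)

lemma approx_number_le:
  assumes "bounded_op T" "bounded_op S" "rk S < enat n"
  shows "a_num n T \<le> op_norm (\<lambda>x. T x - S x)"
  unfolding approx_number_def
  by (intro cInf_lower approx_number_bdd_below) (use assms in auto)

text \<open>The infimum that defines \<open>a_num n\<close> is over a nonempty set as soon as \<open>n \<ge> 1\<close>.\<close>

lemma zero_in_competitors: "n \<ge> 1 \<Longrightarrow> bounded_op (\<lambda>x. 0) \<and> rk (\<lambda>x. 0) < enat n"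
  using bounded_op_zero op_rank_less_1_iff[of "\<lambda>x. 0"]
  by (auto intro: order_less_le_trans)

lemma approx_number_ge:
  assumes "n \<ge> 1" "\<And>S. bounded_op S \<Longrightarrow> rk S < enat n \<Longrightarrow> c \<le> op_norm (\<lambda>x. T x - S x)"
  shows "c \<le> a_num n T"
  unfolding approx_number_def
proof (rule cInf_greatest)
  show "{op_norm (\<lambda>x. T x - S x) |S. bounded_op S \<and> rk S < enat n} \<noteq> {}"
    using zero_in_competitors[OF assms(1)] by blast
qed (use assms(2) in auto)

lemma approx_number_nonneg: "bounded_op T \<Longrightarrow> n \<ge> 1 \<Longrightarrow> 0 \<le> a_num n T"
  by (intro approx_number_ge op_norm_nonneg bounded_op_diff)

lemma approx_number_1: "a_num 1 T = op_norm T"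
proof -
  have "{op_norm (\<lambda>x. T x - S x) |S. bounded_op S \<and> rk S < enat 1} = {op_norm T}"
    using zero_in_competitors[of 1] unfolding op_rank_less_1_iff
    by (auto intro!: exI[of _ "\<lambda>x. 0"])
  then show ?thesis
    unfolding approx_number_def by simp
qed

lemma approx_number_antimono:
  assumes "bounded_op T" "1 \<le> n" "n \<le> m"
  shows "a_num m T \<le> a_num n T"
proof (intro approx_number_ge approx_number_le assms)
  fix S :: "'x \<Rightarrow> 'y" assume "rk S < enat n"
  also have "enat n \<le> enat m"
    using assms(3) by simp
  finally show "rk S < enat m" .
qed

lemma approx_number_eq_0_if_rank_less:
  assumes "bounded_op T" "n \<ge> 1" "rk T < enat n"
  shows "a_num n T = 0"
proof (rule antisym)
  have "a_num n T \<le> op_norm (\<lambda>x. T x - T x)"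
    by (rule approx_number_le) (use assms in auto)
  also have "\<dots> \<le> 0"
    by (rule op_norm_leI) simp
  finally show "a_num n T \<le> 0" .
qed (rule approx_number_nonneg[OF assms(1,2)])

text \<open>Writing the infimum as a limit allows an inequality between operator norms to pass to the
  approximation numbers whenever its right-hand side is continuous.\<close>

lemma approximating_sequence:
  assumes T: "bounded_op T" and n: "n \<ge> 1"
  obtains R where "\<And>j. bounded_op (R j)" "\<And>j. rk (R j) < enat n"
    "(\<lambda>j. op_norm (\<lambda>x. T x - R j x)) \<longlonglongrightarrow> a_num n T"
proof -
  let ?A = "{op_norm (\<lambda>x. T x - S x) |S. bounded_op S \<and> rk S < enat n}"
  have ne: "?A \<noteq> {}"
    using zero_in_competitors[OF n] by blast
  have "\<exists>S. (bounded_op S \<and> rk S < enat n) \<and>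
      op_norm (\<lambda>x. T x - S x) < a_num n T + inverse (real (Suc j))" for j :: nat
  proof -
    have "Inf ?A < a_num n T + inverse (real (Suc j))"
      unfolding approx_number_def by simp
    from cInf_lessD[OF ne this] show ?thesis by blast
  qed
  then obtain R where R: "\<And>j. bounded_op (R j)" "\<And>j. rk (R j) < enat n"
    "\<And>j. op_norm (\<lambda>x. T x - R j x) < a_num n T + inverse (real (Suc j))"
    by metis
  have "(\<lambda>j. op_norm (\<lambda>x. T x - R j x)) \<longlonglongrightarrow> a_num n T"
  proof (rule tendsto_sandwich)
    show "\<forall>\<^sub>F j in sequentially. a_num n T \<le> op_norm (\<lambda>x. T x - R j x)"
      using approx_number_le[OF T R(1,2)] by simp
    show "\<forall>\<^sub>F j in sequentially. op_norm (\<lambda>x. T x - R j x) \<le> a_num n T + inverse (real (Suc j))"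
      using R(3) by (simp add: less_imp_le)
    show "(\<lambda>j. a_num n T + inverse (real (Suc j))) \<longlonglongrightarrow> a_num n T"
      using tendsto_add[OF tendsto_const LIMSEQ_inverse_real_of_nat] by simp
    show "(\<lambda>j. a_num n T) \<longlonglongrightarrow> a_num n T"
      by (rule tendsto_const)
  qed
  with R(1,2) show thesis by (rule that)
qed

text \<open>The part of additivity that does not depend on the form of the triangle inequality in the
  target space: \<open>P j\<close> and \<open>Q j\<close> are the errors of approximating \<open>S\<close> and \<open>T\<close>.\<close>

lemma approx_number_add_le_sequences:
  assumes S: "bounded_op S" and T: "bounded_op T" and mn: "m \<ge> 1" "n \<ge> 1"
  obtains P Q where "\<And>j. bounded_op (P j)" "\<And>j. bounded_op (Q j)"
    "\<And>j. a_num (m + n - 1) (\<lambda>x. S x + T x) \<le> op_norm (\<lambda>x. P j x + Q j x)"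
    "(\<lambda>j. op_norm (P j)) \<longlonglongrightarrow> a_num m S" "(\<lambda>j. op_norm (Q j)) \<longlonglongrightarrow> a_num n T"
proof -
  obtain A where A: "\<And>j. bounded_op (A j)" "\<And>j. rk (A j) < enat m"
    "(\<lambda>j. op_norm (\<lambda>x. S x - A j x)) \<longlonglongrightarrow> a_num m S"
    using approximating_sequence[OF S mn(1)] by blast
  obtain B where B: "\<And>j. bounded_op (B j)" "\<And>j. rk (B j) < enat n"
    "(\<lambda>j. op_norm (\<lambda>x. T x - B j x)) \<longlonglongrightarrow> a_num n T"
    using approximating_sequence[OF T mn(2)] by blast
  have "a_num (m + n - 1) (\<lambda>x. S x + T x) \<le> op_norm (\<lambda>x. S x - A j x + (T x - B j x))" for j
    using approx_number_le[OF bounded_op_add[OF S T] bounded_op_add[OF A(1) B(1)]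
        op_rank_add_less[OF A(2) B(2)], of j j]
    by (simp add: algebra_simps)
  then show thesis
    using that[of "\<lambda>j x. S x - A j x" "\<lambda>j x. T x - B j x"] A B bounded_op_diff S T by blast
qed

lemma approx_number_add:
  assumes S: "bounded_op S" and T: "bounded_op T" and mn: "m \<ge> 1" "n \<ge> 1"
  shows "a_num (m + n - 1) (\<lambda>x. S x + T x) \<le> CY * (a_num m S + a_num n T)"
proof -
  obtain P Q where PQ: "\<And>j. bounded_op (P j)" "\<And>j. bounded_op (Q j)"
    and le: "\<And>j. a_num (m + n - 1) (\<lambda>x. S x + T x) \<le> op_norm (\<lambda>x. P j x + Q j x)"
    and P: "(\<lambda>j. op_norm (P j)) \<longlonglongrightarrow> a_num m S" and Q: "(\<lambda>j. op_norm (Q j)) \<longlonglongrightarrow> a_num n T"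
    using approx_number_add_le_sequences[OF assms] by blast
  have "op_norm (\<lambda>x. P j x + Q j x) \<le> CY * (op_norm (P j) + op_norm (Q j))" for j
  proof (rule op_norm_leI)
    fix x assume x: "qX x \<le> 1"
    have "qY (P j x + Q j x) \<le> CY * (qY (P j x) + qY (Q j x))"
      by (rule Y.qnorm_triangle)
    also have "\<dots> \<le> CY * (op_norm (P j) + op_norm (Q j))"
      using Y.const_pos op_norm_upper[OF PQ(1) x] op_norm_upper[OF PQ(2) x]
      by (intro mult_left_mono add_mono) auto
    finally show "qY (P j x + Q j x) \<le> CY * (op_norm (P j) + op_norm (Q j))" .
  qed
  then have "a_num (m + n - 1) (\<lambda>x. S x + T x) \<le> CY * (op_norm (P j) + op_norm (Q j))" for j
    using le order_trans by blast
  then show ?thesis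
    using LIMSEQ_le_const[OF tendsto_mult[OF tendsto_const tendsto_add[OF P Q]]] by blast
qed

text \<open>The triangle inequality bounds \<open>\<rho>\<close>-th powers, whereas the operator norm is a supremum of
  first powers; taking \<open>\<rho>\<close>-th roots before the supremum and \<open>\<rho>\<close>-th powers after it bridges the
  two.\<close>

lemma approx_number_add_powr:
  assumes S: "bounded_op S" and T: "bounded_op T" and mn: "m \<ge> 1" "n \<ge> 1"
    and rho: "\<rho> > 0" and sub: "\<And>u v. qY (u + v) powr \<rho> \<le> qY u powr \<rho> + qY v powr \<rho>"
  shows "a_num (m + n - 1) (\<lambda>x. S x + T x) powr \<rho> \<le> a_num m S powr \<rho> + a_num n T powr \<rho>"
proof -
  obtain P Q where PQ: "\<And>j. bounded_op (P j)" "\<And>j. bounded_op (Q j)"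
    and le: "\<And>j. a_num (m + n - 1) (\<lambda>x. S x + T x) \<le> op_norm (\<lambda>x. P j x + Q j x)"
    and P: "(\<lambda>j. op_norm (P j)) \<longlonglongrightarrow> a_num m S" and Q: "(\<lambda>j. op_norm (Q j)) \<longlonglongrightarrow> a_num n T"
    using approx_number_add_le_sequences[OF S T mn] by blast
  have nonneg: "0 \<le> a_num (m + n - 1) (\<lambda>x. S x + T x)"
    by (rule approx_number_nonneg[OF bounded_op_add[OF S T]]) (use mn in simp)
  have "a_num (m + n - 1) (\<lambda>x. S x + T x) powr \<rho> \<le> op_norm (P j) powr \<rho> + op_norm (Q j) powr \<rho>" for j
  proof -
    define R where "R = op_norm (P j) powr \<rho> + op_norm (Q j) powr \<rho>"
    have R: "R \<ge> 0"
      by (simp add: R_def)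
    have "op_norm (\<lambda>x. P j x + Q j x) \<le> R powr (1 / \<rho>)"
    proof (rule op_norm_leI)
      fix x assume x: "qX x \<le> 1"
      have "qY (P j x + Q j x) powr \<rho> \<le> qY (P j x) powr \<rho> + qY (Q j x) powr \<rho>"
        by (rule sub)
      also have "\<dots> \<le> R"
        unfolding R_def using rho op_norm_upper[OF PQ(1) x] op_norm_upper[OF PQ(2) x]
        by (intro add_mono powr_mono2) (auto simp: Y.qnorm_nonneg)
      finally have "(qY (P j x + Q j x) powr \<rho>) powr (1 / \<rho>) \<le> R powr (1 / \<rho>)"
        using rho by (intro powr_mono2) auto
      then show "qY (P j x + Q j x) \<le> R powr (1 / \<rho>)"
        using rho Y.qnorm_nonneg[of "P j x + Q j x"] by (simp add: powr_powr)
    qed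
    with le[of j] have "a_num (m + n - 1) (\<lambda>x. S x + T x) powr \<rho> \<le> (R powr (1 / \<rho>)) powr \<rho>"
      using rho nonneg by (intro powr_mono2) auto
    then show ?thesis
      using rho R by (simp add: powr_powr flip: R_def)
  qed
  moreover have "(\<lambda>j. op_norm (P j) powr \<rho> + op_norm (Q j) powr \<rho>)
      \<longlonglongrightarrow> a_num m S powr \<rho> + a_num n T powr \<rho>"
    using rho PQ by (intro tendsto_add tendsto_powr' P Q tendsto_const)
      (auto intro!: always_eventually op_norm_nonneg)
  ultimately show ?thesis
    using LIMSEQ_le_const by blast
qed

text \<open>A finite-rank operator within \<open>\<epsilon>\<close> of \<open>T\<close> sends a bounded set to a bounded subset of a
  finite-dimensional space, and a finite net of that image is a net of the image under \<open>T\<close>.\<close>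

lemma totally_bounded_image_if_approx_number_tendsto_0:
  assumes T: "bounded_op T" and lim: "(\<lambda>n. a_num n T) \<longlonglongrightarrow> 0" and B: "\<And>x. x \<in> B \<Longrightarrow> qX x \<le> M"
  shows "Y.totally_bounded_set (T ` B)"
  unfolding Y.totally_bounded_set_def
proof (intro allI impI)
  fix e :: real assume "e > 0"
  \<comment> \<open>a positive bound, so that one can divide by it\<close>
  define M' where "M' = max M 1"
  have M': "M' > 0" and B': "\<And>x. x \<in> B \<Longrightarrow> qX x \<le> M'"
    using B by (force simp: M'_def)+
  define d where "d = e / (2 * CY)"
  have d: "d > 0"
    using \<open>e > 0\<close> Y.const_pos by (simp add: d_def)
  then have dM: "d / M' > 0"
    using M' by simp
  from order_tendstoD(2)[OF lim this] obtain N where "\<And>n. n \<ge> N \<Longrightarrow> a_num n T < d / M'"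
    by (auto simp: eventually_sequentially)
  \<comment> \<open>approximating sequences exist for positive indices only\<close>
  then have N: "a_num (max N 1) T < d / M'"
    by simp
  obtain R where R: "\<And>j. bounded_op (R j)" "\<And>j. rk (R j) < enat (max N 1)"
    "(\<lambda>j. op_norm (\<lambda>x. T x - R j x)) \<longlonglongrightarrow> a_num (max N 1) T"
    using approximating_sequence[OF T, of "max N 1"] by auto
  from order_tendstoD(2)[OF R(3) N] obtain j where j: "op_norm (\<lambda>x. T x - R j x) < d / M'"
    by (auto simp: eventually_sequentially)
  obtain D where D: "finite D" "range (R j) \<subseteq> Y.span D"
    using R(2)[of j] unfolding op_rank_less_iff by blast
  have "Y.totally_bounded_set (R j ` B)"
  proof (rule Y.totally_bounded_set_if_bounded_in_span[OF D(1)])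
    show "R j ` B \<subseteq> Y.span D"
      using D(2) by blast
    fix y assume "y \<in> R j ` B"
    then obtain x where x: "x \<in> B" "y = R j x" by blast
    have "qY (R j x) \<le> op_norm (R j) * qX x"
      by (rule op_norm_bound[OF R(1)])
    also have "\<dots> \<le> op_norm (R j) * M'"
      by (intro mult_left_mono B' x op_norm_nonneg R(1))
    finally show "qY y \<le> op_norm (R j) * M'"
      using x(2) by simp
  qed
  then obtain F where F: "finite F" "\<And>x. x \<in> B \<Longrightarrow> \<exists>f\<in>F. qY (R j x - f) < d"
    using Y.totally_bounded_set_image_net d by meson
  have "\<exists>f\<in>F. qY (T x - f) < e" if x: "x \<in> B" for x
  proof -
    have "qY (T x - R j x) \<le> op_norm (\<lambda>x. T x - R j x) * qX x"
      by (rule op_norm_bound[OF bounded_op_diff[OF T R(1)]])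
    also have "\<dots> \<le> op_norm (\<lambda>x. T x - R j x) * M'"
      by (intro mult_left_mono B' x op_norm_nonneg bounded_op_diff T R(1))
    also have "\<dots> < d"
      using j M' by (simp add: field_simps)
    finally have "qY (T x - R j x) < e / (2 * CY)"
      by (simp add: d_def)
    then show ?thesis
      using F(2)[OF x] Y.qnorm_less_via unfolding d_def by blast
  qed
  then show "\<exists>F. finite F \<and> (\<forall>y\<in>T ` B. \<exists>f\<in>F. qY (y - f) < e)"
    using F(1) by blast
qed

end

lemma compact_operator_if_approx_number_tendsto_0:
  assumes "quasi_normed_space sX qX CX" and Y: "quasi_banach_space sY qY CY"
    and "bounded_operator sX qX sY qY T"
    and "(\<lambda>n. approx_number sX qX sY qY n T) \<longlonglongrightarrow> 0"
  shows "compact_operator qX qY T"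
proof -
  interpret Y: quasi_banach_space sY qY CY by fact
  interpret quasi_normed_space_pair sX qX CX sY qY CY
    using assms(1) Y.quasi_normed_space_axioms by (simp add: quasi_normed_space_pair_def)
  show ?thesis
    unfolding compact_operator_def
    using totally_bounded_image_if_approx_number_tendsto_0[OF assms(3,4)]
      Y.relatively_compact_if_totally_bounded by blast
qed

text \<open>If \<open>S\<^sub>0\<close> and \<open>T\<^sub>0\<close> approximate \<open>S\<close> and \<open>T\<close>, then
  \<open>S T - (S\<^sub>0 (T - T\<^sub>0) + S T\<^sub>0) = (S - S\<^sub>0) (T - T\<^sub>0)\<close>, where the subtracted operator has rank at
  most the sum of the two ranks.\<close>

lemma approx_number_comp:
  assumes X: "quasi_normed_space sX qX CX" and Y: "quasi_normed_space sY qY CY"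
    and W: "quasi_normed_space sW qW CW"
    and S: "bounded_operator sY qY sW qW S" and T: "bounded_operator sX qX sY qY T"
    and mn: "m \<ge> 1" "n \<ge> 1"
  shows "approx_number sX qX sW qW (m + n - 1) (S \<circ> T)
    \<le> approx_number sY qY sW qW m S * approx_number sX qX sY qY n T"
proof -
  interpret XY: quasi_normed_space_pair sX qX CX sY qY CY
    using X Y by (simp add: quasi_normed_space_pair_def)
  interpret YW: quasi_normed_space_pair sY qY CY sW qW CW
    using Y W by (simp add: quasi_normed_space_pair_def)
  interpret XW: quasi_normed_space_pair sX qX CX sW qW CW
    using X W by (simp add: quasi_normed_space_pair_def)
  have bounded_comp: "XW.bounded_op (\<lambda>x. P (Q x))"
    and norm_comp: "XW.op_norm (\<lambda>x. P (Q x)) \<le> YW.op_norm P * XY.op_norm Q"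
    if P: "YW.bounded_op P" and Q: "XY.bounded_op Q" for P Q
  proof -
    have "qW (P (Q x)) \<le> YW.op_norm P * XY.op_norm Q * qX x" for x
    proof -
      have "qW (P (Q x)) \<le> YW.op_norm P * qY (Q x)"
        by (rule YW.op_norm_bound[OF P])
      also have "\<dots> \<le> YW.op_norm P * (XY.op_norm Q * qX x)"
        by (intro mult_left_mono XY.op_norm_bound Q YW.op_norm_nonneg P)
      finally show ?thesis by (simp add: mult.assoc)
    qed
    note bound = this
    have "Vector_Spaces.linear sX sW (P \<circ> Q)"
      by (rule Vector_Spaces.linear_compose[OF XY.bounded_op_linear[OF Q] YW.bounded_op_linear[OF P]])
    then show "XW.bounded_op (\<lambda>x. P (Q x))"
      using bound unfolding bounded_operator_def comp_def by blast
    show "XW.op_norm (\<lambda>x. P (Q x)) \<le> YW.op_norm P * XY.op_norm Q"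
    proof (rule XW.op_norm_leI)
      fix x assume "qX x \<le> 1"
      with bound[of x] show "qW (P (Q x)) \<le> YW.op_norm P * XY.op_norm Q"
        using mult_left_le[of "qX x" "YW.op_norm P * XY.op_norm Q"]
          YW.op_norm_nonneg[OF P] XY.op_norm_nonneg[OF Q] by fastforce
    qed
  qed
  obtain A where A: "\<And>j. YW.bounded_op (A j)" "\<And>j. YW.rk (A j) < enat m"
    "(\<lambda>j. YW.op_norm (\<lambda>x. S x - A j x)) \<longlonglongrightarrow> YW.a_num m S"
    using YW.approximating_sequence[OF S mn(1)] by blast
  obtain B where B: "\<And>j. XY.bounded_op (B j)" "\<And>j. XY.rk (B j) < enat n"
    "(\<lambda>j. XY.op_norm (\<lambda>x. T x - B j x)) \<longlonglongrightarrow> XY.a_num n T"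
    using XY.approximating_sequence[OF T mn(2)] by blast
  have "XW.a_num (m + n - 1) (S \<circ> T)
      \<le> YW.op_norm (\<lambda>x. S x - A j x) * XY.op_norm (\<lambda>x. T x - B j x)" for j
  proof -
    have TB: "XY.bounded_op (\<lambda>x. T x - B j x)"
      by (intro XY.bounded_op_diff T B)
    have "Vector_Spaces.linear sY sW (A j)" "Vector_Spaces.linear sY sW S"
      using A(1) S YW.bounded_op_linear by blast+
    note lin = YW.linear_diff[OF this(1)] YW.linear_diff[OF this(2)] this(2)
    obtain D where D: "finite D" "card D < m" "range (A j) \<subseteq> YW.Y.span D"
      using A(2)[of j] unfolding YW.op_rank_less_iff by blast
    have rk1: "XW.rk (\<lambda>x. A j (T x - B j x)) < enat m"
      unfolding XW.op_rank_less_iff using D by (intro exI[of _ D]) auto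
    obtain E where E: "finite E" "card E < n" "range (B j) \<subseteq> XY.Y.span E"
      using B(2)[of j] unfolding XY.op_rank_less_iff by blast
    have "S (B j x) \<in> YW.Y.span (S ` E)" for x
      using YW.linear_span_image[OF lin(3), of E] E(3) by blast
    moreover have "card (S ` E) < n"
      using card_image_le[OF E(1), of S] E(2) by linarith
    ultimately have rk2: "XW.rk (\<lambda>x. S (B j x)) < enat n"
      unfolding XW.op_rank_less_iff using E(1) by (intro exI[of _ "S ` E"]) auto
    have "XW.a_num (m + n - 1) (S \<circ> T)
        \<le> XW.op_norm (\<lambda>x. (S \<circ> T) x - (A j (T x - B j x) + S (B j x)))"
    proof (rule XW.approx_number_le)
      show "XW.bounded_op (S \<circ> T)"
        using bounded_comp[OF S T] by (simp add: comp_def)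
      show "XW.bounded_op (\<lambda>x. A j (T x - B j x) + S (B j x))"
        by (intro XW.bounded_op_add bounded_comp[OF A(1) TB] bounded_comp[OF S B(1)])
      show "XW.rk (\<lambda>x. A j (T x - B j x) + S (B j x)) < enat (m + n - 1)"
        by (rule XW.op_rank_add_less[OF rk1 rk2])
    qed
    also have "(\<lambda>x. (S \<circ> T) x - (A j (T x - B j x) + S (B j x)))
        = (\<lambda>x. S (T x - B j x) - A j (T x - B j x))"
      by (simp add: lin fun_eq_iff algebra_simps)
    also have "XW.op_norm \<dots> \<le> YW.op_norm (\<lambda>x. S x - A j x) * XY.op_norm (\<lambda>x. T x - B j x)"
      by (rule norm_comp[OF YW.bounded_op_diff[OF S A(1)] TB])
    finally show ?thesis .
  qed
  then show ?thesis
    using LIMSEQ_le_const[OF tendsto_mult[OF A(3) B(3)]] by blast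
qed

text \<open>An injective \<open>S\<close> of rank less than \<open>n\<close> would map a basis to an independent set with fewer
  than \<open>n\<close> elements. So every competitor has a nonzero vector in its kernel, which \<open>id - S\<close>
  fixes.\<close>

lemma approx_number_id:
  assumes X: "quasi_normed_space sX qX CX" and n: "n \<ge> 1" "enat n \<le> edim sX UNIV"
  shows "approx_number sX qX sX qX n id = 1"
proof -
  interpret quasi_normed_space_pair sX qX CX sX qX CX
    using X by (simp add: quasi_normed_space_pair_def)
  have id: "bounded_op id"
    unfolding bounded_operator_def using X.linear_id by (auto intro!: exI[of _ 1])
  have small_basis: False if "finite B" "card B < n" "X.span B = UNIV" for B
    using that X.edim_less_enat_iff[of UNIV n] n(2) by (auto simp: not_less[symmetric])
  have "op_norm id \<le> 1"
    by (rule op_norm_leI) simp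
  then have "a_num n id \<le> 1"
    using approx_number_antimono[OF id order_refl n(1)] approx_number_1[of id] by linarith
  moreover have "1 \<le> a_num n id"
  proof (rule approx_number_ge[OF n(1)])
    fix S assume S: "bounded_op S" "rk S < enat n"
    then obtain B where B: "finite B" "card B < n" "range S \<subseteq> X.span B"
      unfolding op_rank_less_iff by blast
    have lin: "Vector_Spaces.linear sX sX S"
      by (rule bounded_op_linear[OF S(1)])
    have "\<not> inj S"
    proof
      assume inj: "inj S"
      obtain E where E: "X.independent E" "UNIV \<subseteq> X.span E"
        using X.basis_exists[of UNIV] by blast
      have "X.independent (S ` E)"
        using linear_independent_injective_image[OF lin E(1)] inj inj_on_subset by blast
      then have "finite (S ` E)" "card (S ` E) \<le> card B"
        using X.independent_span_bound[OF B(1)] B(3) by blast+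
      moreover have "inj_on S E"
        using inj inj_on_subset by blast
      ultimately have "finite E" "card E < n"
        using B(2) by (auto simp: card_image dest: finite_imageD)
      then show False
        using small_basis E(2) by blast
    qed
    then obtain x where x: "S x = 0" "x \<noteq> 0"
      using linear_inj_iff_eq_0[OF lin] by blast
    have "qX (id x - S x) \<le> op_norm (\<lambda>x. id x - S x) * qX x"
      by (rule op_norm_bound[OF bounded_op_diff[OF id S(1)]])
    moreover have "qX x > 0"
      using x(2) X.qnorm_nonneg[of x] X.qnorm_eq_0_iff[of x] by linarith
    ultimately show "1 \<le> op_norm (\<lambda>x. id x - S x)"
      using x(1) by simp
  qed
  ultimately show ?thesis by linarith
qed

section \<open>Equivalent \<open>\<rho>\<close>-norms\<close>

text \<open>Estimating both terms on the right-hand side of the \<open>\<rho>\<close>-triangle inequality by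
  \<open>(\<parallel>x\<parallel> + \<parallel>y\<parallel>)\<^sup>\<rho>\<close> and taking \<open>\<rho>\<close>-th roots gives the constant. This makes the results on
  quasi-norms available for \<open>\<rho>\<close>-norms.\<close>

lemma (in rho_normed_space) quasi_normed_space: "quasi_normed_space scale rnorm (2 powr (1 / \<rho>))"
proof
  show "1 \<le> 2 powr (1 / \<rho>)"
    using rho_range by (intro ge_one_powr_ge_zero) auto
  fix x y :: 'a
  let ?s = "rnorm x + rnorm y"
  have s: "rnorm x \<le> ?s" "rnorm y \<le> ?s" "0 \<le> ?s"
    using rnorm_nonneg[of x] rnorm_nonneg[of y] by linarith+
  have "rnorm (x + y) powr \<rho> \<le> rnorm x powr \<rho> + rnorm y powr \<rho>"
    by (rule rnorm_triangle)
  also have "\<dots> \<le> ?s powr \<rho> + ?s powr \<rho>"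
    using s rho_range rnorm_nonneg by (intro add_mono powr_mono2) auto
  finally have "(rnorm (x + y) powr \<rho>) powr (1 / \<rho>) \<le> (2 * ?s powr \<rho>) powr (1 / \<rho>)"
    using rho_range by (intro powr_mono2) auto
  also have "\<dots> = 2 powr (1 / \<rho>) * ?s"
    using s rho_range by (simp add: powr_mult powr_powr)
  finally show "rnorm (x + y) \<le> 2 powr (1 / \<rho>) * (rnorm x + rnorm y)"
    using rnorm_nonneg[of "x + y"] rho_range by (simp add: powr_powr)
qed (simp_all add: rnorm_nonneg rnorm_eq_0_iff rnorm_scale)

lemma bounded_operator_equivalent_qnorm:
  assumes T: "bounded_operator sX qX sY qY T" and eq: "equivalent_qnorms qY rY"
    and rY: "\<And>y. 0 \<le> rY y" and qY: "\<And>y. 0 \<le> qY y"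
  shows "bounded_operator sX qX sY rY T"
proof -
  obtain M where M: "\<And>x. qY (T x) \<le> M * qX x"
    using T by (auto simp: bounded_operator_def)
  obtain c where c: "\<And>y. rY y \<le> c * qY y"
    using eq by (auto simp: equivalent_qnorms_def)
  have "rY (T x) \<le> (max c 0 * M) * qX x" for x
  proof -
    have "rY (T x) \<le> max c 0 * qY (T x)"
      by (rule order_trans[OF c mult_right_mono]) (auto simp: qY)
    also have "\<dots> \<le> max c 0 * (M * qX x)"
      by (intro mult_left_mono M) auto
    finally show ?thesis by (simp add: mult.assoc)
  qed
  then show ?thesis
    using T unfolding bounded_operator_def by blast
qed

theorem theorem16:
  fixes sX :: "'k::{real_normed_field,heine_borel} \<Rightarrow> 'x::ab_group_add \<Rightarrow> 'x"
    and sY :: "'k \<Rightarrow> 'y::ab_group_add \<Rightarrow> 'y"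
    and sW :: "'k \<Rightarrow> 'w::ab_group_add \<Rightarrow> 'w"
    and qX :: "'x \<Rightarrow> real" and qY :: "'y \<Rightarrow> real" and qW :: "'w \<Rightarrow> real"
    and CX CY CW :: real
    and T :: "'x \<Rightarrow> 'y"
  assumes X: "quasi_banach_space sX qX CX"
    and Y: "quasi_banach_space sY qY CY"
    and W: "quasi_banach_space sW qW CW"
    and T: "bounded_operator sX qX sY qY T"
  shows
    "(op_qnorm qX qY T = approx_number sX qX sY qY 1 T \<and>
      (\<forall>n\<ge>1. approx_number sX qX sY qY (n + 1) T \<le> approx_number sX qX sY qY n T) \<and>
      (\<forall>n\<ge>1. 0 \<le> approx_number sX qX sY qY n T)) \<and>

     (\<forall>S m n. bounded_operator sX qX sY qY S \<and> m \<ge> 1 \<and> n \<ge> 1 \<longrightarrow>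
        approx_number sX qX sY qY (m + n - 1) (\<lambda>x. S x + T x)
          \<le> CY * (approx_number sX qX sY qY m S + approx_number sX qX sY qY n T)) \<and>
     (\<forall>rY \<rho>. rho_normed_space sY rY \<rho> \<and> equivalent_qnorms qY rY \<longrightarrow>
        (\<forall>S m n. bounded_operator sX qX sY qY S \<and> m \<ge> 1 \<and> n \<ge> 1 \<longrightarrow>
          approx_number sX qX sY rY (m + n - 1) (\<lambda>x. S x + T x) powr \<rho>
            \<le> approx_number sX qX sY rY m S powr \<rho> + approx_number sX qX sY rY n T powr \<rho>)) \<and>

     (\<forall>S m n. bounded_operator sY qY sW qW S \<and> m \<ge> 1 \<and> n \<ge> 1 \<longrightarrow>
        approx_number sX qX sW qW (m + n - 1) (S \<circ> T)
          \<le> approx_number sY qY sW qW m S * approx_number sX qX sY qY n T) \<and>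

     (\<forall>n\<ge>1. op_rank sY T < enat n \<longrightarrow> approx_number sX qX sY qY n T = 0) \<and>

     (\<forall>n\<ge>1. enat n \<le> edim sX UNIV \<longrightarrow> approx_number sX qX sX qX n id = 1) \<and>

     ((\<lambda>n. approx_number sX qX sY qY n T) \<longlonglongrightarrow> 0 \<longrightarrow> compact_operator qX qY T)"
proof -
  interpret X: quasi_banach_space sX qX CX by fact
  interpret Y: quasi_banach_space sY qY CY by fact
  interpret W: quasi_banach_space sW qW CW by fact
  note spaces = X.quasi_normed_space_axioms Y.quasi_normed_space_axioms
    W.quasi_normed_space_axioms
  interpret XY: quasi_normed_space_pair sX qX CX sY qY CY
    using spaces by (simp add: quasi_normed_space_pair_def)
  show ?thesis
  proof (intro conjI allI impI; (elim conjE)?)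
    show "op_qnorm qX qY T = approx_number sX qX sY qY 1 T"
      by (rule XY.approx_number_1[symmetric])
  next
    fix n :: nat assume "n \<ge> 1"
    then show "approx_number sX qX sY qY (n + 1) T \<le> approx_number sX qX sY qY n T"
      by (intro XY.approx_number_antimono T) auto
  next
    fix n :: nat assume "n \<ge> 1"
    then show "0 \<le> approx_number sX qX sY qY n T"
      by (rule XY.approx_number_nonneg[OF T])
  next
    fix S and m n :: nat
    assume "bounded_operator sX qX sY qY S" "m \<ge> 1" "n \<ge> 1"
    then show "approx_number sX qX sY qY (m + n - 1) (\<lambda>x. S x + T x)
        \<le> CY * (approx_number sX qX sY qY m S + approx_number sX qX sY qY n T)"
      by (intro XY.approx_number_add T)
  next
    fix rY \<rho> S and m n :: nat
    assume r: "rho_normed_space sY rY \<rho>" and eq: "equivalent_qnorms qY rY"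
      and S: "bounded_operator sX qX sY qY S" and mn: "m \<ge> 1" "n \<ge> 1"
    interpret R: rho_normed_space sY rY \<rho> by fact
    interpret XR: quasi_normed_space_pair sX qX CX sY rY "2 powr (1 / \<rho>)"
      using spaces R.quasi_normed_space by (simp add: quasi_normed_space_pair_def)
    note bounded = bounded_operator_equivalent_qnorm[OF _ eq R.rnorm_nonneg Y.qnorm_nonneg]
    show "approx_number sX qX sY rY (m + n - 1) (\<lambda>x. S x + T x) powr \<rho>
        \<le> approx_number sX qX sY rY m S powr \<rho> + approx_number sX qX sY rY n T powr \<rho>"
      by (rule XR.approx_number_add_powr[OF bounded[OF S] bounded[OF T] mn
            R.rho_range(1) R.rnorm_triangle])
  next
    fix S and m n :: nat
    assume "bounded_operator sY qY sW qW S" "m \<ge> 1" "n \<ge> 1"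
    then show "approx_number sX qX sW qW (m + n - 1) (S \<circ> T)
        \<le> approx_number sY qY sW qW m S * approx_number sX qX sY qY n T"
      by (intro approx_number_comp[OF spaces] T)
  next
    fix n :: nat assume "n \<ge> 1" "op_rank sY T < enat n"
    then show "approx_number sX qX sY qY n T = 0"
      by (rule XY.approx_number_eq_0_if_rank_less[OF T])
  next
    fix n :: nat assume "n \<ge> 1" "enat n \<le> edim sX UNIV"
    then show "approx_number sX qX sX qX n id = 1"
      by (rule approx_number_id[OF spaces(1)])
  next
    assume "(\<lambda>n. approx_number sX qX sY qY n T) \<longlonglongrightarrow> 0"
    then show "compact_operator qX qY T"
      by (rule compact_operator_if_approx_number_tendsto_0[OF spaces(1) Y T])
  qed
qed

end
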